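(* Let $N=\{1,\dots,n\}$, $1>q_1\ge\dots\ge q_n\ge0$, and $f(\mathbf{x})=\max\{0,\max_{i\in N}\{q_i-x_i\}\}$ for $\mathbf{x}\in\mathbb{Z}^n$. Let $K\subseteq N$, and let $\boldsymbol\sigma=(\sigma(1),\dots,\sigma(|K|))$ be any (in case of ties) ordering of the elements of $K$ such that $q_{\sigma(1)}\ge\dots\ge q_{\sigma(|K|)}$, with the convention $q_{\sigma(|K|+1)}=0$. Then the mixing inequality $$w\ge\sum_{k=1}^{|K|}(q_{\sigma(k)}-q_{\sigma(k+1)})(1-x_{\sigma(k)})-(1-q_{\sigma(1)})x_{\sigma(|K|)}$$ with respect to $K$ is identical to the SEPI for $f$ associated with $\mathbf{p}\in\mathbb{Z}^n$, where $p_i=-1$ for $i\in K$ and $p_i=1$ otherwise, and the natural ordering $\boldsymbol\delta=(1,\dots,n)$.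
   Context: For $\mathbf{p}\in\mathbb{Z}^n$ and a permutation $\boldsymbol\delta$ of $N$, the SEPI (shifted extremal polymatroid inequality) for $f:\mathbb{Z}^n\to\mathbb{R}$ associated with $(\mathbf{p},\boldsymbol\delta)$ is $$w\ge f(\mathbf{p})+\sum_{i=1}^n\Big[f\Big(\mathbf{p}+\sum_{j=1}^{i}\mathbf{1}^{\delta(j)}\Big)-f\Big(\mathbf{p}+\sum_{j=1}^{i-1}\mathbf{1}^{\delta(j)}\Big)\Big](x_{\delta(i)}-p_{\delta(i)}),$$ with $\mathbf{1}^i$ the $i$-th unit vector. The epigraph of $f$ is the general integer mixing set $\{(w,\mathbf{x})\in\mathbb{R}_+\times\mathbb{Z}^n:w+x_i\ge q_i\ \forall i\in N\}$.
   Formalization: K is assumed nonempty, and the identity with δ=(1,…,n) is stated only when σ lists K in increasing index order; for any other ordering σ of ties, δ is instead (1,…,n) with indices of equal q-value permuted so as to list K in the order σ. *)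

theory Defs
  imports Complex_Main "HOL-Combinatorics.Permutations"
begin

text \<open>
  A point of $\<int>^n$ (or $\<real>^n$) is a function on \<^typ>\<open>nat\<close> of which only the entries with index
  in \<open>{1..n}\<close> are read. An inequality $w \ge g(x)$ in which \<open>w\<close> has coefficient 1 is represented
  by its affine right-hand side \<open>g\<close>, a function of a real vector. Two such inequalities are
  identical, constant and all coefficients included, iff these functions are equal.
\<close>

definition mixing_fun :: "nat \<Rightarrow> (nat \<Rightarrow> real) \<Rightarrow> (nat \<Rightarrow> int) \<Rightarrow> real" where
  "mixing_fun n q x = max 0 (MAX i\<in>{1..n}. q i - of_int (x i))"

definition unit_vec :: "nat \<Rightarrow> nat \<Rightarrow> int" where
  "unit_vec i = (\<lambda>k. if k = i then 1 else 0)"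

definition partial_shift :: "(nat \<Rightarrow> int) \<Rightarrow> (nat \<Rightarrow> nat) \<Rightarrow> nat \<Rightarrow> nat \<Rightarrow> int" where
  "partial_shift p \<delta> i = (\<lambda>k. p k + (\<Sum>j=1..i. unit_vec (\<delta> j) k))"

definition sepi ::
  "nat \<Rightarrow> ((nat \<Rightarrow> int) \<Rightarrow> real) \<Rightarrow> (nat \<Rightarrow> int) \<Rightarrow> (nat \<Rightarrow> nat) \<Rightarrow> (nat \<Rightarrow> real) \<Rightarrow> real" where
  "sepi n f p \<delta> x =
     f p + (\<Sum>i=1..n. (f (partial_shift p \<delta> i) - f (partial_shift p \<delta> (i - 1)))
                       * (x (\<delta> i) - of_int (p (\<delta> i))))"

definition q_along :: "(nat \<Rightarrow> real) \<Rightarrow> nat set \<Rightarrow> (nat \<Rightarrow> nat) \<Rightarrow> nat \<Rightarrow> real" where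
  "q_along q K \<sigma> k = (if k = card K + 1 then 0 else q (\<sigma> k))"

text \<open>Only meaningful for nonempty \<open>K\<close>, since the last term mentions $\sigma(|K|)$.\<close>

definition mixing ::
  "(nat \<Rightarrow> real) \<Rightarrow> nat set \<Rightarrow> (nat \<Rightarrow> nat) \<Rightarrow> (nat \<Rightarrow> real) \<Rightarrow> real" where
  "mixing q K \<sigma> x =
     (\<Sum>k=1..card K. (q_along q K \<sigma> k - q_along q K \<sigma> (k + 1)) * (1 - x (\<sigma> k)))
     - (1 - q_along q K \<sigma> 1) * x (\<sigma> (card K))"

definition base_point :: "nat set \<Rightarrow> nat \<Rightarrow> int" where
  "base_point K = (\<lambda>i. if i \<in> K then -1 else 1)"

text \<open>
  When some \<open>q\<close>-values coincide, the labelling of \<open>N = {1..n}\<close> by nonincreasing \<open>q\<close> is unique only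
  up to permuting indices with equal \<open>q\<close>-value. The natural ordering for a labelling that
  breaks ties inside \<open>K\<close> as \<open>\<sigma>\<close> does is a permutation \<open>\<delta>\<close> that moves indices only within their
  \<open>q\<close>-level and lists \<open>K\<close> in the order \<open>\<sigma>\<close>. If the \<open>q\<close>-values are distinct, \<open>\<delta> = id\<close> is forced.
\<close>

definition natural_order_for ::
  "nat \<Rightarrow> (nat \<Rightarrow> real) \<Rightarrow> nat set \<Rightarrow> (nat \<Rightarrow> nat) \<Rightarrow> (nat \<Rightarrow> nat) \<Rightarrow> bool" where
  "natural_order_for n q K \<sigma> \<delta> \<longleftrightarrow>
     \<delta> permutes {1..n} \<and> (\<forall>i\<in>{1..n}. q (\<delta> i) = q i) \<and>
     strict_mono_on {1..card K} (\<lambda>k. inv \<delta> (\<sigma> k))"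

end

theory Submission
  imports Defs "HOL-Library.Infinite_Set"
begin

text \<open>
  Let \<open>y i\<close> be the point \<open>p\<close> after the first \<open>i\<close> unit shifts. Indices outside \<open>K\<close> never contribute
  to \<open>f (y i)\<close>. As long as some index of \<open>K\<close> is unshifted, \<open>f (y i) = 1 + q k\<close> for the first such
  index \<open>k\<close>, because \<open>q < 1\<close>; after that \<open>f (y i)\<close> is \<open>q\<close> at the first element of \<open>K\<close>. So only
  \<open>i \<in> K\<close> contribute to the SEPI, with differences of consecutive \<open>q\<close>-values, and a telescoping sum
  gives the constant. Relabelling by a permutation that preserves \<open>q\<close> reduces every tie-breaking
  to \<open>\<delta> = id\<close>.
\<close>

section \<open>Enumerations of a set with nonincreasing \<open>q\<close>\<close>

text \<open>A counting argument: how many elements of \<open>K\<close> have \<open>q\<close>-value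
  at least \<open>c\<close> does not depend on the enumeration. With \<open>c = q (t k)\<close> and
  \<open>q (s k) < c\<close>, monotonicity would give at least \<open>k\<close> such positions for
  \<open>t\<close> but at most \<open>k - 1\<close> for \<open>s\<close>.\<close>

lemma antimono_enumerations_le:
  fixes q :: "'a \<Rightarrow> real"
  assumes s: "bij_betw s {1..m} K" and t: "bij_betw t {1..m} K"
    and anti: "antimono_on {1..m} (q \<circ> s)" "antimono_on {1..m} (q \<circ> t)"
    and k: "k \<in> {1..m::nat}"
  shows "q (t k) \<le> q (s k)"
proof (rule ccontr)
  assume "\<not> ?thesis"
  then have less: "q (s k) < q (t k)" by simp
  define c where "c = q (t k)"
  have count: "card {i \<in> {1..m}. c \<le> q (u i)} = card {x \<in> K. c \<le> q x}"
    if "bij_betw u {1..m} K" for u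
  proof (rule bij_betw_same_card[OF bij_betw_subset[OF that]])
    show "u ` {i \<in> {1..m}. c \<le> q (u i)} = {x \<in> K. c \<le> q x}"
      using that unfolding bij_betw_def by blast
  qed blast
  have "{1..k} \<subseteq> {i \<in> {1..m}. c \<le> q (t i)}"
    using anti(2) k by (auto simp: c_def monotone_on_def)
  from card_mono[OF _ this] have "k \<le> card {i \<in> {1..m}. c \<le> q (t i)}" by simp
  moreover have "{i \<in> {1..m}. c \<le> q (s i)} \<subseteq> {1..<k}"
  proof
    fix i assume i: "i \<in> {i \<in> {1..m}. c \<le> q (s i)}"
    have "\<not> k \<le> i"
      using monotone_onD[OF anti(1) k, of i] i less by (auto simp: c_def)
    then show "i \<in> {1..<k}" using i by auto
  qed
  from card_mono[OF _ this] have "card {i \<in> {1..m}. c \<le> q (s i)} \<le> k - 1" by simp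
  ultimately show False using count[OF s] count[OF t] k by auto
qed

lemma antimono_enumerations_eq:
  fixes q :: "'a \<Rightarrow> real"
  assumes "bij_betw s {1..m} K" "bij_betw t {1..m} K"
    and "antimono_on {1..m} (q \<circ> s)" "antimono_on {1..m} (q \<circ> t)" "k \<in> {1..m::nat}"
  shows "q (s k) = q (t k)"
  using antimono_enumerations_le[OF assms(1,2,3,4,5)] antimono_enumerations_le[OF assms(2,1,4,3,5)]
  by simp

text \<open>The witness sends the k-th element of \<open>K\<close> in index order to
  \<open>\<sigma> k\<close> and fixes everything outside \<open>K\<close>. Since \<open>q\<close> is
  nonincreasing, the index order is also a nonincreasing enumeration of \<open>K\<close>, so both
  enumerations carry the same \<open>q\<close>-values position by position.\<close>

lemma natural_order_for_exists:
  assumes q: "antimono_on {1..n} q" and K: "K \<subseteq> {1..n}"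
    and bij: "bij_betw \<sigma> {1..card K} K" and anti: "antimono_on {1..card K} (q \<circ> \<sigma>)"
  shows "\<exists>\<delta>. natural_order_for n q K \<sigma> \<delta>"
proof -
  have "finite K" using K finite_subset by blast
  then obtain h where h: "bij_betw h {..<card K} K" "strict_mono_on {..<card K} h"
    by (rule ex_bij_betw_strict_mono_card)
  \<comment> \<open>The increasing enumeration \<open>h\<close> counts from 0, whereas
    \<open>\<sigma>\<close> counts from 1.\<close>
  define s where "s = h \<circ> (\<lambda>k. k - 1)"
  have "bij_betw (\<lambda>k. k - 1) {1..card K} {..<card K}"
    by (rule bij_betwI[where g = Suc]) auto
  then have s: "bij_betw s {1..card K} K"
    unfolding s_def using h(1) by (rule bij_betw_trans)
  have mono: "strict_mono_on {1..card K} s"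
    using h(2) by (auto simp: s_def monotone_on_def)
  have "antimono_on {1..card K} (q \<circ> s)"
  proof (rule monotone_onI)
    fix k l assume kl: "k \<in> {1..card K}" "l \<in> {1..card K}" "k \<le> l"
    then have "s k \<in> {1..n}" "s l \<in> {1..n}" using bij_betwE[OF s] K by blast+
    then show "(q \<circ> s) l \<le> (q \<circ> s) k"
      using monotone_onD[OF q] strict_mono_on_leD[OF mono kl] by simp
  qed
  note qs = antimono_enumerations_eq[OF s bij this anti]
  define \<delta> where "\<delta> = (\<lambda>i. if i \<in> K then \<sigma> (inv_into {1..card K} s i) else i)"
  have \<delta>s: "\<delta> (s k) = \<sigma> k" if "k \<in> {1..card K}" for k
    using that s bij_betwE[OF s] by (simp add: \<delta>_def bij_betw_inv_into_left)
  have "bij_betw (\<sigma> \<circ> inv_into {1..card K} s) K K"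
    using bij_betw_trans[OF bij_betw_inv_into[OF s] bij] .
  then have "bij_betw \<delta> K K"
    by (rule bij_betw_cong[THEN iffD1, rotated]) (simp add: \<delta>_def)
  then have "\<delta> permutes K"
    by (rule bij_imp_permutes) (simp add: \<delta>_def)
  then have perm: "\<delta> permutes {1..n}" using K permutes_subset by blast
  have "q (\<delta> i) = q i" for i
  proof (cases "i \<in> K")
    case True
    then obtain k where "k \<in> {1..card K}" "i = s k" using s unfolding bij_betw_def by blast
    then show ?thesis using \<delta>s qs by simp
  qed (simp add: \<delta>_def)
  moreover have "inv \<delta> (\<sigma> k) = s k" if "k \<in> {1..card K}" for k
    using \<delta>s[OF that] permutes_inv_eq[OF perm] by metis
  then have "strict_mono_on {1..card K} (\<lambda>k. inv \<delta> (\<sigma> k))"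
    using mono by (simp add: monotone_on_def)
  ultimately show ?thesis using perm by (auto simp: natural_order_for_def)
qed

section \<open>Relabelling by a \<open>q\<close>-preserving permutation\<close>

lemma mixing_fun_permute:
  assumes "\<delta> permutes {1..n}" "\<forall>i\<in>{1..n}. q (\<delta> i) = q i"
  shows "mixing_fun n q y = mixing_fun n q (y \<circ> \<delta>)"
proof -
  have "(\<lambda>i. q i - of_int (y i)) ` {1..n} = (\<lambda>i. q i - of_int (y i)) ` \<delta> ` {1..n}"
    by (simp only: permutes_image[OF assms(1)])
  also have "\<dots> = (\<lambda>i. q i - of_int ((y \<circ> \<delta>) i)) ` {1..n}"
    unfolding image_image using assms(2) by (intro image_cong) auto
  finally show ?thesis by (simp add: mixing_fun_def)
qed

text \<open>Injectivity of \<open>\<delta>\<close> turns \<open>unit_vec (\<delta> j)\<close>, read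
  through \<open>\<delta>\<close>, into \<open>unit_vec j\<close>.\<close>

lemma partial_shift_permute:
  assumes "\<delta> permutes {1..n}"
  shows "partial_shift p \<delta> i \<circ> \<delta> = partial_shift (p \<circ> \<delta>) id i"
  using permutes_inj[OF assms] by (auto simp: partial_shift_def unit_vec_def inj_eq)

lemma sepi_permute:
  assumes "\<delta> permutes {1..n}" "\<forall>i\<in>{1..n}. q (\<delta> i) = q i"
  shows "sepi n (mixing_fun n q) p \<delta> x = sepi n (mixing_fun n q) (p \<circ> \<delta>) id (x \<circ> \<delta>)"
  by (simp add: sepi_def mixing_fun_permute[OF assms, of p]
      mixing_fun_permute[OF assms, of "partial_shift p \<delta> _"] partial_shift_permute[OF assms(1)])

section \<open>The identity ordering\<close>

lemma partial_shift_id: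
  "partial_shift p id i l = p l + (if 1 \<le> l \<and> l \<le> i then 1 else 0)"
  by (simp add: partial_shift_def unit_vec_def)

lemma mixing_fun_eqI:
  assumes "k \<in> {1..n}" "q k - of_int (y k) = v" "0 \<le> v"
    and "\<And>j. j \<in> {1..n} \<Longrightarrow> q j - of_int (y j) \<le> v"
  shows "mixing_fun n q y = v"
proof -
  have "(MAX i\<in>{1..n}. q i - of_int (y i)) = v"
    using assms by (intro Max_eqI) auto
  then show ?thesis using assms(3) by (simp add: mixing_fun_def)
qed

lemma mixing_eq_sepi_id:
  fixes q :: "nat \<Rightarrow> real"
  assumes q1: "q 1 < 1" and qn: "0 \<le> q n" and anti: "antimono_on {1..n} q"
    and K: "K \<subseteq> {1..n}" "K \<noteq> {}"
    and bij: "bij_betw \<sigma> {1..card K} K" and mono: "strict_mono_on {1..card K} \<sigma>"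
  shows "mixing q K \<sigma> x = sepi n (mixing_fun n q) (base_point K) id x"
proof -
  define m where "m = card K"
  define F where "F i = mixing_fun n q (partial_shift (base_point K) id i)" for i
  note bij = bij[folded m_def] and mono = mono[folded m_def]
  have m: "1 \<le> m" using K finite_subset by (fastforce simp: m_def Suc_le_eq card_gt_0_iff)
  have q_mono: "q j \<le> q i" if "i \<in> {1..n}" "j \<in> {1..n}" "i \<le> j" for i j
    using monotone_onD[OF anti] that by auto
  have q_bounds: "0 \<le> q j" "q j < 1" if "j \<in> {1..n}" for j
    using q_mono[of j n] q_mono[of 1 j] that q1 qn by auto
  \<comment> \<open>Here \<open>k\<close> is the first index of \<open>K\<close> not yet shifted,
    with coordinate -1. Shifted elements of \<open>K\<close> have coordinate 0 and give less than 1,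
    later ones give at most \<open>1 + q k\<close>, and indices outside \<open>K\<close> have
    coordinate at least 1 and give negative values.\<close>
  have F_inside: "F i = 1 + q k"
    if "k \<in> K" "i < k" and first: "\<And>j. j \<in> K \<Longrightarrow> i < j \<Longrightarrow> k \<le> j" for i k
    unfolding F_def
  proof (rule mixing_fun_eqI)
    show k: "k \<in> {1..n}" using that K by auto
    show "q k - of_int (partial_shift (base_point K) id i k) = 1 + q k"
      using that by (simp add: partial_shift_id base_point_def)
    show "0 \<le> 1 + q k" using q_bounds[OF k] by simp
    fix j assume j: "j \<in> {1..n}"
    show "q j - of_int (partial_shift (base_point K) id i j) \<le> 1 + q k"
      using q_bounds[OF j] q_bounds[OF k] q_mono[OF k j] first[of j] j
      by (auto simp: partial_shift_id base_point_def)
  qed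
  \<comment> \<open>All of \<open>K\<close> now has coordinate 0, so its first element attains the
    maximum.\<close>
  have F_after: "F i = q k"
    if "k \<in> K" "K \<subseteq> {1..i}" and first: "\<And>j. j \<in> K \<Longrightarrow> k \<le> j" for i k
    unfolding F_def
  proof (rule mixing_fun_eqI)
    show k: "k \<in> {1..n}" using that K by auto
    show "q k - of_int (partial_shift (base_point K) id i k) = q k"
      using that by (auto simp: partial_shift_id base_point_def)
    show "0 \<le> q k" using q_bounds[OF k] by simp
    fix j assume j: "j \<in> {1..n}"
    show "q j - of_int (partial_shift (base_point K) id i j) \<le> q k"
      using q_bounds[OF j] q_bounds[OF k] q_mono[OF k j] first[of j] j that(2)
      by (auto simp: partial_shift_id base_point_def)
  qed
  have \<sigma>_le: "\<sigma> k \<le> \<sigma> l \<longleftrightarrow> k \<le> l" if "k \<in> {1..m}" "l \<in> {1..m}" for k l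
    using strict_mono_on_leD[OF mono] strict_mono_onD[OF mono] that by (meson not_le)
  have \<sigma>_in: "\<sigma> k \<in> K" if "k \<in> {1..m}" for k using bij that bij_betwE by blast
  have \<sigma>_ex: "\<exists>k\<in>{1..m}. j = \<sigma> k" if "j \<in> K" for j
    using bij that by (auto simp: bij_betw_def)
  have pos: "1 \<le> j" if "j \<in> K" for j using that K by auto
  have F_before: "F (\<sigma> k - 1) = 1 + q (\<sigma> k)" if "k \<in> {1..m}" for k
    using \<sigma>_in[OF that] pos[OF \<sigma>_in[OF that]] by (intro F_inside) auto
  have F_next: "F (\<sigma> k) = 1 + q (\<sigma> (k + 1))" if "k \<in> {1..<m}" for k
  proof (rule F_inside)
    show "\<sigma> (k + 1) \<in> K" "\<sigma> k < \<sigma> (k + 1)"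
      using that \<sigma>_in[of "k + 1"] strict_mono_onD[OF mono, of k "k + 1"] by auto
    fix j assume j: "j \<in> K" "\<sigma> k < j"
    then obtain l where l: "l \<in> {1..m}" "j = \<sigma> l" using \<sigma>_ex by blast
    then show "\<sigma> (k + 1) \<le> j"
      using j that \<sigma>_le[of l k] \<sigma>_le[of "k + 1" l] by auto
  qed
  have first: "\<sigma> 1 \<le> j" and last: "j \<le> \<sigma> m" if "j \<in> K" for j
    using \<sigma>_ex[OF that] \<sigma>_le m by auto
  have F_last: "F (\<sigma> m) = q (\<sigma> 1)"
    using \<sigma>_in[of 1] m first last pos by (intro F_after) auto
  have F_first: "F 0 = 1 + q (\<sigma> 1)"
    using \<sigma>_in[of 1] m first pos[OF \<sigma>_in[of 1]] by (intro F_inside) auto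
  \<comment> \<open>Passing an index outside \<open>K\<close> does not change the set of unshifted
    elements of \<open>K\<close>, so the same index of \<open>K\<close> determines both
    values.\<close>
  have F_const: "F i = F (i - 1)" if "i \<in> {1..n}" "i \<notin> K" for i
  proof (cases "\<exists>j\<in>K. i < j")
    case True
    define k where "k = (LEAST j. j \<in> K \<and> i < j)"
    have k: "k \<in> K" "i < k" and least: "\<And>j. j \<in> K \<Longrightarrow> i < j \<Longrightarrow> k \<le> j"
      unfolding k_def using LeastI_ex[of "\<lambda>j. j \<in> K \<and> i < j"] True
      by (auto intro: Least_le)
    have "i < j" if "j \<in> K" "i - 1 < j" for j
      using that \<open>i \<notin> K\<close> by (cases "i = j") auto
    then have "F (i - 1) = 1 + q k" using k least by (intro F_inside) auto
    then show ?thesis using F_inside[OF k least] by simp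
  next
    case False
    have "j \<le> i - 1" if "j \<in> K" for j
      using that False \<open>i \<notin> K\<close> by (cases "j = i") (auto simp: not_less)
    then have "K \<subseteq> {1..i - 1}" "K \<subseteq> {1..i}" using pos by fastforce+
    then show ?thesis using F_after[of "\<sigma> 1"] \<sigma>_in[of 1] m first by auto
  qed
  let ?G = "\<lambda>i. (F i - F (i - 1)) * (x i - of_int (base_point K i))"
  \<comment> \<open>The last element of \<open>K\<close> is split off: there \<open>F\<close> drops
    from \<open>1 + q (\<sigma> m)\<close> to \<open>q (\<sigma> 1)\<close>, which produces the term
    with coefficient \<open>1 - q (\<sigma> 1)\<close> in the mixing inequality.\<close>
  have top: "{1..m} = insert m {1..<m}" using m by auto
  have "sum ?G {1..n} = sum ?G K"
    using K F_const by (intro sum.mono_neutral_right) auto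
  also have "\<dots> = (\<Sum>k\<in>{1..m}. ?G (\<sigma> k))"
    by (rule sum.reindex_bij_betw[OF bij, symmetric])
  also have "\<dots> = (\<Sum>k\<in>{1..<m}. ?G (\<sigma> k)) + ?G (\<sigma> m)"
    unfolding top by simp
  also have "?G (\<sigma> m) = (q (\<sigma> 1) - 1 - q (\<sigma> m)) * (x (\<sigma> m) + 1)"
    using F_last F_before[of m] \<sigma>_in[of m] m by (simp add: base_point_def)
  \<comment> \<open>On \<open>K\<close> the base point is -1, so the factor is
    \<open>x (\<sigma> k) + 1\<close>. Writing it as \<open>2 - (1 - x (\<sigma> k))\<close>
    separates the mixing term from a constant that telescopes.\<close>
  also have "(\<Sum>k\<in>{1..<m}. ?G (\<sigma> k)) =
      (\<Sum>k\<in>{1..<m}. (q (\<sigma> k) - q (\<sigma> (k + 1))) * (1 - x (\<sigma> k)) + 2 * (q (\<sigma> (k + 1)) - q (\<sigma> k)))"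
  proof (rule sum.cong[OF refl])
    fix k assume k: "k \<in> {1..<m}"
    show "?G (\<sigma> k) =
      (q (\<sigma> k) - q (\<sigma> (k + 1))) * (1 - x (\<sigma> k)) + 2 * (q (\<sigma> (k + 1)) - q (\<sigma> k))"
      using F_next[OF k] F_before[of k] \<sigma>_in[of k] k by (simp add: base_point_def algebra_simps)
  qed
  also have "\<dots> = (\<Sum>k\<in>{1..<m}. (q (\<sigma> k) - q (\<sigma> (k + 1))) * (1 - x (\<sigma> k)))
      + 2 * (q (\<sigma> m) - q (\<sigma> 1))"
    unfolding sum.distrib sum_distrib_left[symmetric] Suc_eq_plus1[symmetric]
      sum_Suc_diff'[OF m, of "\<lambda>k. q (\<sigma> k)"] ..
  finally have sepi: "sepi n (mixing_fun n q) (base_point K) id x =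
      1 + q (\<sigma> 1) + ((\<Sum>k\<in>{1..<m}. (q (\<sigma> k) - q (\<sigma> (k + 1))) * (1 - x (\<sigma> k)))
      + 2 * (q (\<sigma> m) - q (\<sigma> 1)) + (q (\<sigma> 1) - 1 - q (\<sigma> m)) * (x (\<sigma> m) + 1))"
    using F_first by (simp add: sepi_def F_def partial_shift_def)
  \<comment> \<open>The convention value 0 at position \<open>m + 1\<close> leaves
    \<open>q (\<sigma> m)\<close> as the last coefficient.\<close>
  have "(\<Sum>k\<in>{1..m}. (q_along q K \<sigma> k - q_along q K \<sigma> (k + 1)) * (1 - x (\<sigma> k))) =
      (\<Sum>k\<in>{1..<m}. (q (\<sigma> k) - q (\<sigma> (k + 1))) * (1 - x (\<sigma> k))) + q (\<sigma> m) * (1 - x (\<sigma> m))"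
    unfolding top by (simp add: q_along_def m_def)
  then have "mixing q K \<sigma> x = (\<Sum>k\<in>{1..<m}. (q (\<sigma> k) - q (\<sigma> (k + 1))) * (1 - x (\<sigma> k)))
      + q (\<sigma> m) * (1 - x (\<sigma> m)) - (1 - q (\<sigma> 1)) * x (\<sigma> m)"
    using m by (simp add: mixing_def q_along_def m_def)
  then show ?thesis unfolding sepi by (simp add: algebra_simps)
qed

text \<open>Everything is pulled back along \<open>\<delta>\<close>: \<open>K\<close> becomes
  \<open>J\<close>, the point \<open>x\<close> becomes \<open>x \<circ> \<delta>\<close>, and
  \<open>\<sigma>\<close> becomes \<open>inv \<delta> \<circ> \<sigma>\<close>, which is increasing
  by the choice of \<open>\<delta>\<close>. This is the identity case for \<open>J\<close>.\<close>

lemma mixing_eq_sepi: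
  fixes q :: "nat \<Rightarrow> real"
  assumes q: "q 1 < 1" "0 \<le> q n" "antimono_on {1..n} q"
    and K: "K \<subseteq> {1..n}" "K \<noteq> {}" and bij: "bij_betw \<sigma> {1..card K} K"
    and nat: "natural_order_for n q K \<sigma> \<delta>"
  shows "mixing q K \<sigma> = sepi n (mixing_fun n q) (base_point K) \<delta>"
proof
  fix x :: "nat \<Rightarrow> real"
  have perm: "\<delta> permutes {1..n}" and q\<delta>: "\<forall>i\<in>{1..n}. q (\<delta> i) = q i"
    and mono: "strict_mono_on {1..card K} (inv \<delta> \<circ> \<sigma>)"
    using nat by (auto simp: natural_order_for_def comp_def)
  define J where "J = inv \<delta> ` K"
  have inv_bij: "bij_betw (inv \<delta>) K J"
    using permutes_inj[OF permutes_inv[OF perm]]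
    by (auto simp: J_def bij_betw_def intro: inj_on_subset)
  have card: "card J = card K" using bij_betw_same_card[OF inv_bij] by simp
  have J: "J \<subseteq> {1..n}" "J \<noteq> {}"
    using K permutes_image[OF permutes_inv[OF perm]] by (auto simp: J_def)
  have base: "base_point K \<circ> \<delta> = base_point J"
  proof -
    have "\<delta> i \<in> K \<longleftrightarrow> i \<in> J" for i
      using permutes_inverses[OF perm] unfolding J_def image_iff by metis
    then show ?thesis by (auto simp: base_point_def)
  qed
  \<comment> \<open>Position \<open>card K + 1\<close> is included because the last difference reads
    it; both sides are 0 there since \<open>J\<close> and \<open>K\<close> have equal size.\<close>
  have along: "q_along q K \<sigma> k = q_along q J (inv \<delta> \<circ> \<sigma>) k" if "k \<in> {1..card K + 1}" for k
  proof (cases "k = card K + 1")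
    case False
    then have "\<sigma> k \<in> {1..n}" using that bij_betwE[OF bij] K by fastforce
    then have "inv \<delta> (\<sigma> k) \<in> {1..n}" using permutes_in_image[OF permutes_inv[OF perm]] by blast
    then have "q (inv \<delta> (\<sigma> k)) = q (\<sigma> k)" using q\<delta> permutes_inverses(1)[OF perm] by metis
    then show ?thesis using False by (simp add: q_along_def card)
  qed (simp add: q_along_def card)
  have "mixing q K \<sigma> x = mixing q J (inv \<delta> \<circ> \<sigma>) (x \<circ> \<delta>)"
    using along by (simp add: mixing_def card permutes_inverses[OF perm])
  also have "\<dots> = sepi n (mixing_fun n q) (base_point J) id (x \<circ> \<delta>)"
    using q J mono bij_betw_trans[OF bij inv_bij]
    by (intro mixing_eq_sepi_id) (simp_all add: card)
  also have "\<dots> = sepi n (mixing_fun n q) (base_point K) \<delta> x"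
    using sepi_permute[OF perm q\<delta>] base by simp
  finally show "mixing q K \<sigma> x = sepi n (mixing_fun n q) (base_point K) \<delta> x" .
qed

theorem proposition3p11:
  fixes n :: nat and q :: "nat \<Rightarrow> real" and K :: "nat set" and \<sigma> :: "nat \<Rightarrow> nat"
  assumes "q 1 < 1" and "0 \<le> q n" and "antimono_on {1..n} q"
    and "K \<subseteq> {1..n}" and "K \<noteq> {}"
    and "bij_betw \<sigma> {1..card K} K" and "antimono_on {1..card K} (q \<circ> \<sigma>)"
  shows "(strict_mono_on {1..card K} \<sigma> \<longrightarrow>
            mixing q K \<sigma> = sepi n (mixing_fun n q) (base_point K) id)
       \<and> (\<exists>\<delta>. natural_order_for n q K \<sigma> \<delta>)
       \<and> (\<forall>\<delta>. natural_order_for n q K \<sigma> \<delta> \<longrightarrow>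
            mixing q K \<sigma> = sepi n (mixing_fun n q) (base_point K) \<delta>)"
  using mixing_eq_sepi_id[OF assms(1-6)] natural_order_for_exists[OF assms(3,4,6,7)]
    mixing_eq_sepi[OF assms(1-6)] by blast

end
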